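(* Let $\mathcal{A}$ be an abelian category, $n\geq 1$, $I=\{1,\dots,n\}$, let $F=(F_i)_{i\in I}$ be a family of additive covariant endofunctors of $\mathcal{A}$ with an associative family $\Phi=(\Phi_{i,j}:F_iF_j\to F_{i+j})$ of natural transformations, and suppose that each $F_i$ admits a right adjoint $G_i$. Put $G=(G_i)_{i\in I}$. Then there exists a coassociative family $\Psi=(\Psi_{i,j}:G_{i+j}\to G_iG_j)$ of natural transformations such that the right $n$-trivial extension $\mathcal{A}\ltimes_n F$ (with respect to $\Phi$) is isomorphic to the left $n$-trivial extension $G\rtimes_n\mathcal{A}$ (with respect to $\Psi$).
   Context: Right $n$-trivial extension: $\Phi$ consists of natural transformations $\Phi_{i,j}:F_iF_j\to F_{i+j}$ for $i,j\in I$ with $i+j\in I$; it is associative if $(\Phi_{i,j+k})_X\circ F_i((\Phi_{j,k})_X)=(\Phi_{i+j,k})_X\circ(\Phi_{i,j})_{F_kX}$ for all objects $X$ and all $i,j,k\in I$ with $i+j+k\in I$. Objects of $\mathcal{A}\ltimes_n F$ are pairs $(X,f)$ with $X$ in $\mathcal{A}$ and $f=(f_i:F_iX\to X)_{i\in I}$ such that for all $i,j\in I$: $f_i\circ F_i(f_j)=f_{i+j}\circ(\Phi_{i,j})_X$ if $i+j\leq n$, and $f_i\circ F_i(f_j)=0$ if $i+j>n$. A morphism $(X,\alpha)\to(Y,\beta)$ is a morphism $\gamma:X\to Y$ in $\mathcal{A}$ with $\gamma\circ\alpha_i=\beta_i\circ F_i(\gamma)$ for all $i$. Left $n$-trivial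 extension: $\Psi$ consists of natural transformations $\Psi_{i,j}:G_{i+j}\to G_iG_j$ for $i,j\in I$ with $i+j\in I$; it is coassociative if $G_i((\Psi_{j,k})_X)\circ(\Psi_{i,j+k})_X=(\Psi_{i,j})_{G_kX}\circ(\Psi_{i+j,k})_X$ for all objects $X$ and all $i,j,k\in I$ with $i+j+k\in I$. Objects of $G\rtimes_n\mathcal{A}$ are pairs $(X,g)$ with $X$ in $\mathcal{A}$ and $g=(g_i:X\to G_iX)_{i\in I}$ such that for all $i,j\in I$: $G_i(g_j)\circ g_i=(\Psi_{i,j})_X\circ g_{i+j}$ if $i+j\leq n$, and $G_i(g_j)\circ g_i=0$ if $i+j>n$. A morphism $(X,\alpha)\to(Y,\beta)$ is a morphism $\gamma:X\to Y$ in $\mathcal{A}$ with $\beta_i\circ\gamma=G_i(\gamma)\circ\alpha_i$ for all $i$. *)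

theory Defs
  imports "HOL-Algebra.Group"
begin

section \<open>Categories, functors, natural transformations\<close>

text \<open>Composition is written in the usual order: \<open>g \<cdot> f\<close> is \<open>g\<close> after \<open>f\<close>.  The operations are
  total HOL functions; their values are only meaningful on \<open>Obj\<close>, on \<open>Arr\<close> and on composable
  pairs of arrows.\<close>

record ('o, 'a) category =
  Obj :: "'o set"
  Arr :: "'a set"
  Dom :: "'a \<Rightarrow> 'o"
  Cod :: "'a \<Rightarrow> 'o"
  Ident :: "'o \<Rightarrow> 'a"
  Comp :: "'a \<Rightarrow> 'a \<Rightarrow> 'a"  (infixr "\<cdot>\<index>" 70)

definition homset :: "('o, 'a, 'z) category_scheme \<Rightarrow> 'o \<Rightarrow> 'o \<Rightarrow> 'a set" where
  "homset C X Y = {f \<in> Arr C. Dom C f = X \<and> Cod C f = Y}"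

locale category =
  fixes C :: "('o, 'a, 'z) category_scheme" (structure)
  assumes Dom_in_Obj: "f \<in> Arr C \<Longrightarrow> Dom C f \<in> Obj C"
    and Cod_in_Obj: "f \<in> Arr C \<Longrightarrow> Cod C f \<in> Obj C"
    and Ident_in_homset: "X \<in> Obj C \<Longrightarrow> Ident C X \<in> homset C X X"
    and Comp_in_homset: "\<lbrakk>f \<in> homset C X Y; g \<in> homset C Y Z\<rbrakk> \<Longrightarrow> g \<cdot> f \<in> homset C X Z"
    and Comp_Ident_right: "f \<in> homset C X Y \<Longrightarrow> f \<cdot> Ident C X = f"
    and Comp_Ident_left: "f \<in> homset C X Y \<Longrightarrow> Ident C Y \<cdot> f = f"
    and Comp_assoc: "\<lbrakk>f \<in> homset C W X; g \<in> homset C X Y; h \<in> homset C Y Z\<rbrakk>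
      \<Longrightarrow> (h \<cdot> g) \<cdot> f = h \<cdot> (g \<cdot> f)"

record ('o, 'a, 'p, 'b) funct =
  fobj :: "'o \<Rightarrow> 'p"
  farr :: "'a \<Rightarrow> 'b"

locale category_functor = source: category C + target: category D
  for C :: "('o, 'a, 'y) category_scheme" and D :: "('p, 'b, 'z) category_scheme" +
  fixes F :: "('o, 'a, 'p, 'b) funct"
  assumes fobj_in_Obj: "X \<in> Obj C \<Longrightarrow> fobj F X \<in> Obj D"
    and farr_in_homset: "f \<in> homset C X Y \<Longrightarrow> farr F f \<in> homset D (fobj F X) (fobj F Y)"
    and farr_Ident: "X \<in> Obj C \<Longrightarrow> farr F (Ident C X) = Ident D (fobj F X)"
    and farr_Comp: "\<lbrakk>f \<in> homset C X Y; g \<in> homset C Y Z\<rbrakk>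
      \<Longrightarrow> farr F (g \<cdot>\<^bsub>C\<^esub> f) = farr F g \<cdot>\<^bsub>D\<^esub> farr F f"

definition funct_comp ::
    "('p, 'b, 'q, 'c) funct \<Rightarrow> ('o, 'a, 'p, 'b) funct \<Rightarrow> ('o, 'a, 'q, 'c) funct"
    (infixr "\<circ>\<^sub>F" 75) where
  "F \<circ>\<^sub>F G = \<lparr>fobj = fobj F \<circ> fobj G, farr = farr F \<circ> farr G\<rparr>"

text \<open>A natural transformation is given by its components.\<close>

locale natural_transformation = F: category_functor C D F + G: category_functor C D G
  for C :: "('o, 'a, 'y) category_scheme" and D :: "('p, 'b, 'z) category_scheme"
    and F :: "('o, 'a, 'p, 'b) funct" and G :: "('o, 'a, 'p, 'b) funct" +
  fixes \<tau> :: "'o \<Rightarrow> 'b"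
  assumes component_in_homset: "X \<in> Obj C \<Longrightarrow> \<tau> X \<in> homset D (fobj F X) (fobj G X)"
    and naturality: "f \<in> homset C X Y \<Longrightarrow> \<tau> Y \<cdot>\<^bsub>D\<^esub> farr F f = farr G f \<cdot>\<^bsub>D\<^esub> \<tau> X"

definition isomorphic_categories ::
    "('o, 'a, 'y) category_scheme \<Rightarrow> ('p, 'b, 'z) category_scheme \<Rightarrow> bool" where
  "isomorphic_categories C D \<longleftrightarrow>
    (\<exists>(S :: ('o, 'a, 'p, 'b) funct) (T :: ('p, 'b, 'o, 'a) funct).
      category_functor C D S \<and> category_functor D C T \<and>
      (\<forall>X \<in> Obj C. fobj (T \<circ>\<^sub>F S) X = X) \<and> (\<forall>f \<in> Arr C. farr (T \<circ>\<^sub>F S) f = f) \<and>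
      (\<forall>Y \<in> Obj D. fobj (S \<circ>\<^sub>F T) Y = Y) \<and> (\<forall>g \<in> Arr D. farr (S \<circ>\<^sub>F T) g = g))"

text \<open>\<open>\<phi> X Y\<close> is the bijection from \<open>Hom\<^sub>D (F X) Y\<close> to \<open>Hom\<^sub>C X (G Y)\<close>, natural in both variables;
  \<open>F\<close> is the left adjoint.\<close>

locale adjunction = left: category_functor C D F + right: category_functor D C G
  for C :: "('o, 'a, 'y) category_scheme" and D :: "('p, 'b, 'z) category_scheme"
    and F :: "('o, 'a, 'p, 'b) funct" and G :: "('p, 'b, 'o, 'a) funct" +
  fixes \<phi> :: "'o \<Rightarrow> 'p \<Rightarrow> 'b \<Rightarrow> 'a"
  assumes bij: "\<lbrakk>X \<in> Obj C; Y \<in> Obj D\<rbrakk>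
      \<Longrightarrow> bij_betw (\<phi> X Y) (homset D (fobj F X) Y) (homset C X (fobj G Y))"
    and natural: "\<lbrakk>X \<in> Obj C; Y \<in> Obj D; u \<in> homset C X' X;
        f \<in> homset D (fobj F X) Y; v \<in> homset D Y Y'\<rbrakk>
      \<Longrightarrow> \<phi> X' Y' (v \<cdot>\<^bsub>D\<^esub> f \<cdot>\<^bsub>D\<^esub> farr F u) = farr G v \<cdot>\<^bsub>C\<^esub> \<phi> X Y f \<cdot>\<^bsub>C\<^esub> u"

definition is_right_adjoint ::
    "('o, 'a, 'y) category_scheme \<Rightarrow> ('p, 'b, 'z) category_scheme
      \<Rightarrow> ('o, 'a, 'p, 'b) funct \<Rightarrow> ('p, 'b, 'o, 'a) funct \<Rightarrow> bool" where
  "is_right_adjoint C D F G \<longleftrightarrow> (\<exists>\<phi>. adjunction C D F G \<phi>)"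


section \<open>Abelian categories\<close>

record ('o, 'a) preadditive_category = "('o, 'a) category" +
  Add :: "'a \<Rightarrow> 'a \<Rightarrow> 'a"
  Zero :: "'o \<Rightarrow> 'o \<Rightarrow> 'a"

definition hom_group ::
    "('o, 'a, 'z) preadditive_category_scheme \<Rightarrow> 'o \<Rightarrow> 'o \<Rightarrow> 'a monoid" where
  "hom_group C X Y = \<lparr>carrier = homset C X Y, monoid.mult = Add C, one = Zero C X Y\<rparr>"

locale preadditive_category = category C
  for C :: "('o, 'a, 'z) preadditive_category_scheme" (structure) +
  assumes comm_group_hom: "\<lbrakk>X \<in> Obj C; Y \<in> Obj C\<rbrakk> \<Longrightarrow> comm_group (hom_group C X Y)"
    and Comp_Add_right: "\<lbrakk>f \<in> homset C X Y; f' \<in> homset C X Y; g \<in> homset C Y Z\<rbrakk>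
      \<Longrightarrow> g \<cdot> Add C f f' = Add C (g \<cdot> f) (g \<cdot> f')"
    and Comp_Add_left: "\<lbrakk>f \<in> homset C X Y; g \<in> homset C Y Z; g' \<in> homset C Y Z\<rbrakk>
      \<Longrightarrow> Add C g g' \<cdot> f = Add C (g \<cdot> f) (g' \<cdot> f)"

definition is_zero_object :: "('o, 'a, 'z) category_scheme \<Rightarrow> 'o \<Rightarrow> bool" where
  "is_zero_object C Z \<longleftrightarrow> Z \<in> Obj C \<and>
    (\<forall>X \<in> Obj C. (\<exists>!f. f \<in> homset C X Z) \<and> (\<exists>!f. f \<in> homset C Z X))"

definition is_biproduct :: "('o, 'a, 'z) preadditive_category_scheme
    \<Rightarrow> 'o \<Rightarrow> 'o \<Rightarrow> 'o \<Rightarrow> 'a \<Rightarrow> 'a \<Rightarrow> 'a \<Rightarrow> 'a \<Rightarrow> bool" where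
  "is_biproduct C X Y P p q i j \<longleftrightarrow> P \<in> Obj C \<and>
    p \<in> homset C P X \<and> q \<in> homset C P Y \<and> i \<in> homset C X P \<and> j \<in> homset C Y P \<and>
    p \<cdot>\<^bsub>C\<^esub> i = Ident C X \<and> q \<cdot>\<^bsub>C\<^esub> j = Ident C Y \<and>
    q \<cdot>\<^bsub>C\<^esub> i = Zero C X Y \<and> p \<cdot>\<^bsub>C\<^esub> j = Zero C Y X \<and>
    Add C (i \<cdot>\<^bsub>C\<^esub> p) (j \<cdot>\<^bsub>C\<^esub> q) = Ident C P"

definition is_kernel :: "('o, 'a, 'z) preadditive_category_scheme \<Rightarrow> 'a \<Rightarrow> 'a \<Rightarrow> bool" where
  "is_kernel C f k \<longleftrightarrow> f \<in> Arr C \<and> k \<in> Arr C \<and> Cod C k = Dom C f \<and>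
    f \<cdot>\<^bsub>C\<^esub> k = Zero C (Dom C k) (Cod C f) \<and>
    (\<forall>T \<in> Obj C. \<forall>h \<in> homset C T (Dom C f). f \<cdot>\<^bsub>C\<^esub> h = Zero C T (Cod C f) \<longrightarrow>
      (\<exists>!u. u \<in> homset C T (Dom C k) \<and> k \<cdot>\<^bsub>C\<^esub> u = h))"

definition is_cokernel :: "('o, 'a, 'z) preadditive_category_scheme \<Rightarrow> 'a \<Rightarrow> 'a \<Rightarrow> bool" where
  "is_cokernel C f c \<longleftrightarrow> f \<in> Arr C \<and> c \<in> Arr C \<and> Dom C c = Cod C f \<and>
    c \<cdot>\<^bsub>C\<^esub> f = Zero C (Dom C f) (Cod C c) \<and>
    (\<forall>T \<in> Obj C. \<forall>h \<in> homset C (Cod C f) T. h \<cdot>\<^bsub>C\<^esub> f = Zero C (Dom C f) T \<longrightarrow>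
      (\<exists>!u. u \<in> homset C (Cod C c) T \<and> u \<cdot>\<^bsub>C\<^esub> c = h))"

definition is_monic :: "('o, 'a, 'z) category_scheme \<Rightarrow> 'a \<Rightarrow> bool" where
  "is_monic C m \<longleftrightarrow> m \<in> Arr C \<and>
    (\<forall>T \<in> Obj C. \<forall>u \<in> homset C T (Dom C m). \<forall>v \<in> homset C T (Dom C m).
      m \<cdot>\<^bsub>C\<^esub> u = m \<cdot>\<^bsub>C\<^esub> v \<longrightarrow> u = v)"

definition is_epic :: "('o, 'a, 'z) category_scheme \<Rightarrow> 'a \<Rightarrow> bool" where
  "is_epic C e \<longleftrightarrow> e \<in> Arr C \<and>
    (\<forall>T \<in> Obj C. \<forall>u \<in> homset C (Cod C e) T. \<forall>v \<in> homset C (Cod C e) T.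
      u \<cdot>\<^bsub>C\<^esub> e = v \<cdot>\<^bsub>C\<^esub> e \<longrightarrow> u = v)"

locale abelian_category = preadditive_category C
  for C :: "('o, 'a, 'z) preadditive_category_scheme" (structure) +
  assumes zero_object: "\<exists>Z. is_zero_object C Z"
    and biproducts: "\<lbrakk>X \<in> Obj C; Y \<in> Obj C\<rbrakk> \<Longrightarrow> \<exists>P p q i j. is_biproduct C X Y P p q i j"
    and kernels: "f \<in> Arr C \<Longrightarrow> \<exists>k. is_kernel C f k"
    and cokernels: "f \<in> Arr C \<Longrightarrow> \<exists>c. is_cokernel C f c"
    and monic_is_kernel: "is_monic C m \<Longrightarrow> \<exists>f. is_kernel C f m"
    and epic_is_cokernel: "is_epic C e \<Longrightarrow> \<exists>f. is_cokernel C f e"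

locale additive_functor = category_functor C D F +
    source: preadditive_category C + target: preadditive_category D
  for C :: "('o, 'a, 'y) preadditive_category_scheme"
    and D :: "('p, 'b, 'z) preadditive_category_scheme"
    and F :: "('o, 'a, 'p, 'b) funct" +
  assumes farr_Add: "\<lbrakk>f \<in> homset C X Y; g \<in> homset C X Y\<rbrakk>
      \<Longrightarrow> farr F (Add C f g) = Add D (farr F f) (farr F g)"


section \<open>Trivial extensions\<close>

definition associative_family ::
    "nat \<Rightarrow> ('o, 'a, 'z) category_scheme \<Rightarrow> (nat \<Rightarrow> ('o, 'a, 'o, 'a) funct)
      \<Rightarrow> (nat \<Rightarrow> nat \<Rightarrow> 'o \<Rightarrow> 'a) \<Rightarrow> bool" where
  "associative_family n A F \<Phi> \<longleftrightarrow>
    (\<forall>i \<in> {1..n}. \<forall>j \<in> {1..n}. i + j \<in> {1..n} \<longrightarrow>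
      natural_transformation A A (F i \<circ>\<^sub>F F j) (F (i + j)) (\<Phi> i j)) \<and>
    (\<forall>X \<in> Obj A. \<forall>i \<in> {1..n}. \<forall>j \<in> {1..n}. \<forall>k \<in> {1..n}. i + j + k \<in> {1..n} \<longrightarrow>
      \<Phi> i (j + k) X \<cdot>\<^bsub>A\<^esub> farr (F i) (\<Phi> j k X) = \<Phi> (i + j) k X \<cdot>\<^bsub>A\<^esub> \<Phi> i j (fobj (F k) X))"

definition coassociative_family ::
    "nat \<Rightarrow> ('o, 'a, 'z) category_scheme \<Rightarrow> (nat \<Rightarrow> ('o, 'a, 'o, 'a) funct)
      \<Rightarrow> (nat \<Rightarrow> nat \<Rightarrow> 'o \<Rightarrow> 'a) \<Rightarrow> bool" where
  "coassociative_family n A G \<Psi> \<longleftrightarrow>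
    (\<forall>i \<in> {1..n}. \<forall>j \<in> {1..n}. i + j \<in> {1..n} \<longrightarrow>
      natural_transformation A A (G (i + j)) (G i \<circ>\<^sub>F G j) (\<Psi> i j)) \<and>
    (\<forall>X \<in> Obj A. \<forall>i \<in> {1..n}. \<forall>j \<in> {1..n}. \<forall>k \<in> {1..n}. i + j + k \<in> {1..n} \<longrightarrow>
      farr (G i) (\<Psi> j k X) \<cdot>\<^bsub>A\<^esub> \<Psi> i (j + k) X = \<Psi> i j (fobj (G k) X) \<cdot>\<^bsub>A\<^esub> \<Psi> (i + j) k X)"

text \<open>Families indexed by \<open>{1..n}\<close> are extensional functions on \<open>nat\<close>, so that two families are
  equal iff they agree on \<open>{1..n}\<close>.  A morphism of an extension carries its source and target:
  the same morphism of the base category may underlie several morphisms of the extension.\<close>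

definition right_ext_Obj ::
    "nat \<Rightarrow> ('o, 'a, 'z) preadditive_category_scheme \<Rightarrow> (nat \<Rightarrow> ('o, 'a, 'o, 'a) funct)
      \<Rightarrow> (nat \<Rightarrow> nat \<Rightarrow> 'o \<Rightarrow> 'a) \<Rightarrow> ('o \<times> (nat \<Rightarrow> 'a)) set" where
  "right_ext_Obj n A F \<Phi> = {(X, f). X \<in> Obj A \<and>
    f \<in> (\<Pi>\<^sub>E i \<in> {1..n}. homset A (fobj (F i) X) X) \<and>
    (\<forall>i \<in> {1..n}. \<forall>j \<in> {1..n}.
      (i + j \<le> n \<longrightarrow> f i \<cdot>\<^bsub>A\<^esub> farr (F i) (f j) = f (i + j) \<cdot>\<^bsub>A\<^esub> \<Phi> i j X) \<and>
      (i + j > n \<longrightarrow> f i \<cdot>\<^bsub>A\<^esub> farr (F i) (f j) = Zero A (fobj (F i) (fobj (F j) X)) X))}"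

definition left_ext_Obj ::
    "nat \<Rightarrow> ('o, 'a, 'z) preadditive_category_scheme \<Rightarrow> (nat \<Rightarrow> ('o, 'a, 'o, 'a) funct)
      \<Rightarrow> (nat \<Rightarrow> nat \<Rightarrow> 'o \<Rightarrow> 'a) \<Rightarrow> ('o \<times> (nat \<Rightarrow> 'a)) set" where
  "left_ext_Obj n A G \<Psi> = {(X, g). X \<in> Obj A \<and>
    g \<in> (\<Pi>\<^sub>E i \<in> {1..n}. homset A X (fobj (G i) X)) \<and>
    (\<forall>i \<in> {1..n}. \<forall>j \<in> {1..n}.
      (i + j \<le> n \<longrightarrow> farr (G i) (g j) \<cdot>\<^bsub>A\<^esub> g i = \<Psi> i j X \<cdot>\<^bsub>A\<^esub> g (i + j)) \<and>
      (i + j > n \<longrightarrow> farr (G i) (g j) \<cdot>\<^bsub>A\<^esub> g i = Zero A X (fobj (G i) (fobj (G j) X))))}"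

type_synonym ('o, 'a) ext_obj = "'o \<times> (nat \<Rightarrow> 'a)"
type_synonym ('o, 'a) ext_arr = "('o, 'a) ext_obj \<times> 'a \<times> ('o, 'a) ext_obj"

definition right_trivial_extension ::
    "nat \<Rightarrow> ('o, 'a, 'z) preadditive_category_scheme \<Rightarrow> (nat \<Rightarrow> ('o, 'a, 'o, 'a) funct)
      \<Rightarrow> (nat \<Rightarrow> nat \<Rightarrow> 'o \<Rightarrow> 'a) \<Rightarrow> (('o, 'a) ext_obj, ('o, 'a) ext_arr) category" where
  "right_trivial_extension n A F \<Phi> =
    \<lparr>Obj = right_ext_Obj n A F \<Phi>,
     Arr = {((X, \<alpha>), \<gamma>, (Y, \<beta>)) | X \<alpha> \<gamma> Y \<beta>.
       (X, \<alpha>) \<in> right_ext_Obj n A F \<Phi> \<and> (Y, \<beta>) \<in> right_ext_Obj n A F \<Phi> \<and>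
       \<gamma> \<in> homset A X Y \<and> (\<forall>i \<in> {1..n}. \<gamma> \<cdot>\<^bsub>A\<^esub> \<alpha> i = \<beta> i \<cdot>\<^bsub>A\<^esub> farr (F i) \<gamma>)},
     Dom = (\<lambda>(P, \<gamma>, Q). P),
     Cod = (\<lambda>(P, \<gamma>, Q). Q),
     Ident = (\<lambda>(X, \<alpha>). ((X, \<alpha>), Ident A X, (X, \<alpha>))),
     Comp = (\<lambda>(Q', \<delta>, R) (P, \<gamma>, Q). (P, \<delta> \<cdot>\<^bsub>A\<^esub> \<gamma>, R))\<rparr>"

definition left_trivial_extension ::
    "nat \<Rightarrow> ('o, 'a, 'z) preadditive_category_scheme \<Rightarrow> (nat \<Rightarrow> ('o, 'a, 'o, 'a) funct)
      \<Rightarrow> (nat \<Rightarrow> nat \<Rightarrow> 'o \<Rightarrow> 'a) \<Rightarrow> (('o, 'a) ext_obj, ('o, 'a) ext_arr) category" where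
  "left_trivial_extension n A G \<Psi> =
    \<lparr>Obj = left_ext_Obj n A G \<Psi>,
     Arr = {((X, \<alpha>), \<gamma>, (Y, \<beta>)) | X \<alpha> \<gamma> Y \<beta>.
       (X, \<alpha>) \<in> left_ext_Obj n A G \<Psi> \<and> (Y, \<beta>) \<in> left_ext_Obj n A G \<Psi> \<and>
       \<gamma> \<in> homset A X Y \<and> (\<forall>i \<in> {1..n}. \<beta> i \<cdot>\<^bsub>A\<^esub> \<gamma> = farr (G i) \<gamma> \<cdot>\<^bsub>A\<^esub> \<alpha> i)},
     Dom = (\<lambda>(P, \<gamma>, Q). P),
     Cod = (\<lambda>(P, \<gamma>, Q). Q),
     Ident = (\<lambda>(X, \<alpha>). ((X, \<alpha>), Ident A X, (X, \<alpha>))),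
     Comp = (\<lambda>(Q', \<delta>, R) (P, \<gamma>, Q). (P, \<delta> \<cdot>\<^bsub>A\<^esub> \<gamma>, R))\<rparr>"

end

theory Submission
  imports Defs
begin

text \<open>
  Transposing along \<open>F\<^sub>i \<stileturn> G\<^sub>i\<close> turns \<open>f\<^sub>i : F\<^sub>i X \<rightarrow> X\<close> into \<open>g\<^sub>i : X \<rightarrow> G\<^sub>i X\<close>.  Since
  \<open>F\<^sub>j F\<^sub>i\<close> is left adjoint to \<open>G\<^sub>i G\<^sub>j\<close>, the transformation \<open>\<Psi>\<^sub>i\<^sub>j\<close> has to be the mate of
  \<open>\<Phi>\<^sub>j\<^sub>i\<close>, with the indices swapped.  It is characterised by the identity
  \<open>\<phi>\<^sub>i (\<phi>\<^sub>j (h \<cdot> \<Phi>\<^sub>j\<^sub>i)) = \<Psi>\<^sub>i\<^sub>j \<cdot> \<phi>\<^sub>i\<^sub>+\<^sub>j h\<close> for \<open>h : F\<^sub>i\<^sub>+\<^sub>j Y \<rightarrow> X\<close>, from which naturality,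
  coassociativity and the correspondence of the two kinds of structure on \<open>X\<close> all follow.
\<close>

section \<open>Hom-sets, composite functors and zero morphisms\<close>

lemma (in category) homset_Obj:
  assumes "f \<in> homset C X Y"
  shows "X \<in> Obj C" "Y \<in> Obj C"
  using assms Dom_in_Obj Cod_in_Obj by (auto simp: homset_def)

lemma category_functor_funct_comp:
  assumes "category_functor D E H" "category_functor C D K"
  shows "category_functor C E (H \<circ>\<^sub>F K)"
proof -
  interpret H: category_functor D E H by fact
  interpret K: category_functor C D K by fact
  show ?thesis
    by unfold_locales
      (auto simp: funct_comp_def H.fobj_in_Obj K.fobj_in_Obj H.farr_Ident K.farr_Ident
        K.farr_Comp H.farr_Comp[OF K.farr_in_homset K.farr_in_homset]
        intro: H.farr_in_homset K.farr_in_homset)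
qed

context preadditive_category
begin

lemma Zero_in_homset: "\<lbrakk>X \<in> Obj C; Y \<in> Obj C\<rbrakk> \<Longrightarrow> Zero C X Y \<in> homset C X Y"
  using comm_group_hom[of X Y] monoid.one_closed[of "hom_group C X Y"]
  by (simp add: hom_group_def comm_group_def comm_monoid_def group_def)

text \<open>Cancellation in the group of morphisms. Bilinearity makes any composite with a zero
  morphism idempotent for \<open>Add\<close>, so this lemma yields the two absorption laws for
  \<open>Zero\<close> below.\<close>

lemma Add_idem_eq_Zero:
  assumes "f \<in> homset C X Y" "Add C f f = f"
  shows "f = Zero C X Y"
proof -
  interpret comm_group "hom_group C X Y"
    using comm_group_hom homset_Obj assms(1) by blast
  show ?thesis
    using l_cancel_one[of f f] assms by (simp add: hom_group_def)
qed

lemma Add_Zero_Zero: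
  assumes "X \<in> Obj C" "Y \<in> Obj C"
  shows "Add C (Zero C X Y) (Zero C X Y) = Zero C X Y"
proof -
  interpret comm_group "hom_group C X Y"
    using comm_group_hom assms by blast
  show ?thesis
    using l_one[OF one_closed] by (simp add: hom_group_def)
qed

lemma Comp_Zero_left:
  assumes "f \<in> homset C X Y" "Z \<in> Obj C"
  shows "Zero C Y Z \<cdot> f = Zero C X Z"
proof -
  have Y: "Y \<in> Obj C" using assms homset_Obj by blast
  show ?thesis
    using Comp_Add_left[OF assms(1) Zero_in_homset Zero_in_homset] Add_Zero_Zero Y assms
    by (metis Add_idem_eq_Zero Comp_in_homset Zero_in_homset)
qed

lemma Comp_Zero_right:
  assumes "g \<in> homset C Y Z" "X \<in> Obj C"
  shows "g \<cdot> Zero C X Y = Zero C X Z"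
proof -
  have Y: "Y \<in> Obj C" using assms homset_Obj by blast
  show ?thesis
    using Comp_Add_right[OF Zero_in_homset Zero_in_homset assms(1)] Add_Zero_Zero Y assms
    by (metis Add_idem_eq_Zero Comp_in_homset Zero_in_homset)
qed

end

section \<open>Transposition along a single adjunction\<close>

context adjunction
begin

lemma transpose_in_homset:
  assumes "X \<in> Obj C" "f \<in> homset D (fobj F X) Y"
  shows "\<phi> X Y f \<in> homset C X (fobj G Y)"
  using bij[OF assms(1) left.target.homset_Obj(2)[OF assms(2)]] assms(2)
  by (auto dest: bij_betwE)

lemma transpose_eq_iff:
  assumes "X \<in> Obj C" "f \<in> homset D (fobj F X) Y" "g \<in> homset D (fobj F X) Y"
  shows "\<phi> X Y f = \<phi> X Y g \<longleftrightarrow> f = g"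
  using bij[OF assms(1) left.target.homset_Obj(2)[OF assms(2)]] assms(2,3)
  by (auto simp: bij_betw_def inj_on_def)

text \<open>The axiom \<open>natural\<close> treats both variables at once. Taking the identity of
  \<open>X\<close> for \<open>u\<close> isolates naturality in the codomain;
  \<open>transpose_pre\<close> takes the identity of \<open>Y\<close> for \<open>v\<close>.\<close>

lemma transpose_post:
  assumes "X \<in> Obj C" "f \<in> homset D (fobj F X) Y" "v \<in> homset D Y Y'"
  shows "\<phi> X Y' (v \<cdot>\<^bsub>D\<^esub> f) = farr G v \<cdot>\<^bsub>C\<^esub> \<phi> X Y f"
  using natural[OF assms(1) left.target.homset_Obj(2)[OF assms(2)]
      left.source.Ident_in_homset[OF assms(1)] assms(2,3)]
  by (simp add: left.farr_Ident[OF assms(1)] left.target.Comp_Ident_right[OF assms(2)]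
      left.source.Comp_Ident_right[OF transpose_in_homset[OF assms(1,2)]])

lemma transpose_pre:
  assumes "u \<in> homset C X' X" "f \<in> homset D (fobj F X) Y"
  shows "\<phi> X' Y (f \<cdot>\<^bsub>D\<^esub> farr F u) = \<phi> X Y f \<cdot>\<^bsub>C\<^esub> u"
proof -
  have X: "X \<in> Obj C" and Y: "Y \<in> Obj D"
    using assms left.source.homset_Obj left.target.homset_Obj by blast+
  have "f \<cdot>\<^bsub>D\<^esub> farr F u \<in> homset D (fobj F X') Y"
    "\<phi> X Y f \<cdot>\<^bsub>C\<^esub> u \<in> homset C X' (fobj G Y)"
    using assms X left.farr_in_homset left.target.Comp_in_homset left.source.Comp_in_homset
      transpose_in_homset by blast+
  then show ?thesis
    using natural[OF X Y assms left.target.Ident_in_homset[OF Y]]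
    by (simp add: right.farr_Ident[OF Y] left.target.Comp_Ident_left left.source.Comp_Ident_left)
qed

definition counit :: "'p \<Rightarrow> 'b" where
  "counit Y = inv_into (homset D (fobj F (fobj G Y)) Y) (\<phi> (fobj G Y) Y) (Ident C (fobj G Y))"

lemma
  assumes "Y \<in> Obj D"
  shows counit_in_homset: "counit Y \<in> homset D (fobj F (fobj G Y)) Y"
    and transpose_counit: "\<phi> (fobj G Y) Y (counit Y) = Ident C (fobj G Y)"
proof -
  have "Ident C (fobj G Y) \<in> \<phi> (fobj G Y) Y ` homset D (fobj F (fobj G Y)) Y"
    using bij[OF right.fobj_in_Obj[OF assms] assms]
      left.source.Ident_in_homset[OF right.fobj_in_Obj[OF assms]]
    by (simp add: bij_betw_def)
  then show "counit Y \<in> homset D (fobj F (fobj G Y)) Y"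
    "\<phi> (fobj G Y) Y (counit Y) = Ident C (fobj G Y)"
    unfolding counit_def by (rule inv_into_into, rule f_inv_into_f)
qed

text \<open>Universal property of the counit. By naturality in the domain the transpose of the left
  side is the transpose of the counit, an identity, after \<open>\<phi> X Y f\<close>; injectivity
  of \<open>\<phi>\<close> concludes.\<close>

lemma counit_transpose:
  assumes "X \<in> Obj C" "f \<in> homset D (fobj F X) Y"
  shows "counit Y \<cdot>\<^bsub>D\<^esub> farr F (\<phi> X Y f) = f"
proof -
  have Y: "Y \<in> Obj D"
    using assms left.target.homset_Obj by blast
  note t = transpose_in_homset[OF assms]
  have "\<phi> X Y (counit Y \<cdot>\<^bsub>D\<^esub> farr F (\<phi> X Y f)) = \<phi> X Y f"
    using transpose_pre[OF t counit_in_homset[OF Y]] left.source.Comp_Ident_left[OF t]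
    by (simp add: transpose_counit[OF Y])
  moreover have "counit Y \<cdot>\<^bsub>D\<^esub> farr F (\<phi> X Y f) \<in> homset D (fobj F X) Y"
    using left.target.Comp_in_homset[OF left.farr_in_homset[OF t] counit_in_homset[OF Y]] .
  ultimately show ?thesis
    using transpose_eq_iff assms by blast
qed

end

text \<open>The zero morphism out of \<open>F X\<close> is unchanged by precomposing the image under
  \<open>F\<close> of the zero endomorphism of \<open>X\<close>. By naturality its transpose then
  factors through that zero endomorphism.\<close>

lemma transpose_Zero:
  assumes "preadditive_category C" "preadditive_category D" "adjunction C D F G \<phi>"
    "X \<in> Obj C" "Y \<in> Obj D"
  shows "\<phi> X Y (Zero D (fobj F X) Y) = Zero C X (fobj G Y)"
proof -
  interpret C: preadditive_category C by fact
  interpret D: preadditive_category D by fact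
  interpret adjunction C D F G \<phi> by fact
  note z = C.Zero_in_homset[OF assms(4,4)]
  note zD = D.Zero_in_homset[OF left.fobj_in_Obj[OF assms(4)] assms(5)]
  have "\<phi> X Y (Zero D (fobj F X) Y) = \<phi> X Y (Zero D (fobj F X) Y \<cdot>\<^bsub>D\<^esub> farr F (Zero C X X))"
    using D.Comp_Zero_left[OF left.farr_in_homset[OF z] assms(5)] by simp
  also have "\<dots> = \<phi> X Y (Zero D (fobj F X) Y) \<cdot>\<^bsub>C\<^esub> Zero C X X"
    using transpose_pre[OF z zD] .
  also have "\<dots> = Zero C X (fobj G Y)"
    using C.Comp_Zero_right[OF transpose_in_homset[OF assms(4) zD] assms(4)] .
  finally show ?thesis .
qed

section \<open>Categories of objects with extra structure over a base category\<close>

definition structure_category ::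
    "('o, 'a, 'z) category_scheme \<Rightarrow> ('o \<times> 's) set \<Rightarrow> ('o \<times> 's \<Rightarrow> 'a \<Rightarrow> 'o \<times> 's \<Rightarrow> bool)
      \<Rightarrow> ('o \<times> 's, ('o \<times> 's) \<times> 'a \<times> ('o \<times> 's)) category" where
  "structure_category C Ob R =
    \<lparr>Obj = Ob,
     Arr = {(P, \<gamma>, Q). P \<in> Ob \<and> Q \<in> Ob \<and> \<gamma> \<in> homset C (fst P) (fst Q) \<and> R P \<gamma> Q},
     Dom = (\<lambda>(P, \<gamma>, Q). P),
     Cod = (\<lambda>(P, \<gamma>, Q). Q),
     Ident = (\<lambda>P. (P, Ident C (fst P), P)),
     Comp = (\<lambda>(Q', \<delta>, R) (P, \<gamma>, Q). (P, \<delta> \<cdot>\<^bsub>C\<^esub> \<gamma>, R))\<rparr>"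

lemma structure_category_simps:
  "Obj (structure_category C Ob R) = Ob"
  "Ident (structure_category C Ob R) P = (P, Ident C (fst P), P)"
  "(Q', \<delta>, S) \<cdot>\<^bsub>structure_category C Ob R\<^esub> (P, \<gamma>, Q) = (P, \<delta> \<cdot>\<^bsub>C\<^esub> \<gamma>, S)"
  "(P, \<gamma>, Q) \<in> Arr (structure_category C Ob R) \<longleftrightarrow>
    P \<in> Ob \<and> Q \<in> Ob \<and> \<gamma> \<in> homset C (fst P) (fst Q) \<and> R P \<gamma> Q"
  "Dom (structure_category C Ob R) (P, \<gamma>, Q) = P"
  "Cod (structure_category C Ob R) (P, \<gamma>, Q) = Q"
  "(P', \<gamma>, Q') \<in> homset (structure_category C Ob R) P Q \<longleftrightarrow>
    P' = P \<and> Q' = Q \<and> P \<in> Ob \<and> Q \<in> Ob \<and> \<gamma> \<in> homset C (fst P) (fst Q) \<and> R P \<gamma> Q"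
  by (auto simp: structure_category_def homset_def)

text \<open>Common frame for both trivial extensions: \<open>'s\<close> is the type of structure
  families and \<open>R\<close> is the condition on a base morphism to be a morphism of the
  extension.\<close>

locale structures = category C for C :: "('o, 'a, 'z) category_scheme" (structure) +
  fixes Ob :: "('o \<times> 's) set" and R :: "'o \<times> 's \<Rightarrow> 'a \<Rightarrow> 'o \<times> 's \<Rightarrow> bool"
  assumes fst_in_Obj: "P \<in> Ob \<Longrightarrow> fst P \<in> Obj C"
    and R_Ident: "P \<in> Ob \<Longrightarrow> R P (Ident C (fst P)) P"
    and R_Comp: "\<lbrakk>P \<in> Ob; Q \<in> Ob; S \<in> Ob; \<gamma> \<in> homset C (fst P) (fst Q);
      \<delta> \<in> homset C (fst Q) (fst S); R P \<gamma> Q; R Q \<delta> S\<rbrakk> \<Longrightarrow> R P (\<delta> \<cdot> \<gamma>) S"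

sublocale structures \<subseteq> structured: category "structure_category C Ob R"
proof (unfold_locales, goal_cases)
  \<comment> \<open>Goals 4 and 7 are closure under composition and associativity, where several
    arrows have to be split into triples.\<close>
  case (4 f X Y g Z)
  then show ?case
    by (cases f; cases g) (auto simp: structure_category_simps intro: Comp_in_homset R_Comp)
next
  case (7 f W X g Y h Z)
  then show ?case
    by (cases f; cases g; cases h) (auto simp: structure_category_simps Comp_assoc)
qed (auto simp: structure_category_simps fst_in_Obj R_Ident Ident_in_homset
    Comp_Ident_right Comp_Ident_left)

definition structure_functor ::
    "('o \<times> 's \<Rightarrow> 'o \<times> 't) \<Rightarrow> ('o \<times> 's, ('o \<times> 's) \<times> 'a \<times> ('o \<times> 's),
      'o \<times> 't, ('o \<times> 't) \<times> 'a \<times> ('o \<times> 't)) funct" where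
  "structure_functor s = \<lparr>fobj = s, farr = (\<lambda>(P, \<gamma>, Q). (s P, \<gamma>, s Q))\<rparr>"

lemma structure_functor:
  assumes "structures C Ob R" "structures C Ob' R'"
    and "\<And>P. P \<in> Ob \<Longrightarrow> s P \<in> Ob' \<and> fst (s P) = fst P"
    and "\<And>P Q \<gamma>. \<lbrakk>P \<in> Ob; Q \<in> Ob; \<gamma> \<in> homset C (fst P) (fst Q); R P \<gamma> Q\<rbrakk>
      \<Longrightarrow> R' (s P) \<gamma> (s Q)"
  shows "category_functor (structure_category C Ob R) (structure_category C Ob' R')
    (structure_functor s)"
proof -
  interpret S: structures C Ob R by fact
  interpret T: structures C Ob' R' by fact
  show ?thesis
    by unfold_locales
      (auto simp: structure_functor_def structure_category_simps assms(3,4))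
qed

text \<open>The functors induced by \<open>s\<close> and \<open>t\<close> keep the underlying base
  morphism, so being inverse on arrows reduces to being inverse on objects.\<close>

lemma isomorphic_structure_categories:
  assumes "structures C Ob R" "structures C Ob' R'"
    and s: "\<And>P. P \<in> Ob \<Longrightarrow> s P \<in> Ob' \<and> fst (s P) = fst P \<and> t (s P) = P"
    and t: "\<And>P. P \<in> Ob' \<Longrightarrow> t P \<in> Ob \<and> fst (t P) = fst P \<and> s (t P) = P"
    and R: "\<And>P Q \<gamma>. \<lbrakk>P \<in> Ob; Q \<in> Ob; \<gamma> \<in> homset C (fst P) (fst Q)\<rbrakk>
      \<Longrightarrow> R' (s P) \<gamma> (s Q) \<longleftrightarrow> R P \<gamma> Q"
  shows "isomorphic_categories (structure_category C Ob R) (structure_category C Ob' R')"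
  unfolding isomorphic_categories_def
proof (intro exI conjI)
  show "category_functor (structure_category C Ob R) (structure_category C Ob' R')
    (structure_functor s)"
    using assms by (intro structure_functor) auto
  show "category_functor (structure_category C Ob' R') (structure_category C Ob R)
    (structure_functor t)"
  proof (rule structure_functor[OF assms(2,1)])
    fix P Q \<gamma>
    assume "P \<in> Ob'" "Q \<in> Ob'" "\<gamma> \<in> homset C (fst P) (fst Q)" "R' P \<gamma> Q"
    \<comment> \<open>Since \<open>s\<close> undoes \<open>t\<close>, the equivalence for
      \<open>s\<close> at \<open>t P\<close> and \<open>t Q\<close> is the compatibility of
      \<open>t\<close>.\<close>
    then show "R (t P) \<gamma> (t Q)"
      using R[of "t P" "t Q" \<gamma>] t by simp
  qed (use t in auto)
qed (use s t in \<open>auto simp: structure_functor_def funct_comp_def structure_category_simps\<close>)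

section \<open>A family of adjunctions together with an associative family
  \<open>\<Phi>\<close>\<close>

locale graded_adjunction = preadditive_category A
  for A :: "('o, 'a, 'z) preadditive_category_scheme" (structure) +
  fixes n :: nat
    and F G :: "nat \<Rightarrow> ('o, 'a, 'o, 'a) funct"
    and \<phi> :: "nat \<Rightarrow> 'o \<Rightarrow> 'o \<Rightarrow> 'a \<Rightarrow> 'a"
    and \<Phi> :: "nat \<Rightarrow> nat \<Rightarrow> 'o \<Rightarrow> 'a"
  assumes adj: "i \<in> {1..n} \<Longrightarrow> adjunction A A (F i) (G i) (\<phi> i)"
    and assoc: "associative_family n A F \<Phi>"
begin

lemma F: "i \<in> {1..n} \<Longrightarrow> category_functor A A (F i)"
  using adj by (simp add: adjunction_def)

lemma G: "i \<in> {1..n} \<Longrightarrow> category_functor A A (G i)"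
  using adj by (simp add: adjunction_def)

lemmas F_Obj = category_functor.fobj_in_Obj[OF F]
lemmas G_Obj = category_functor.fobj_in_Obj[OF G]
lemmas F_hom = category_functor.farr_in_homset[OF F]
lemmas G_hom = category_functor.farr_in_homset[OF G]
lemmas F_Ident = category_functor.farr_Ident[OF F]
lemmas G_Ident = category_functor.farr_Ident[OF G]
lemmas F_Comp = category_functor.farr_Comp[OF F]
lemmas G_Comp = category_functor.farr_Comp[OF G]
lemmas \<phi>_hom = adjunction.transpose_in_homset[OF adj]
lemmas \<phi>_eq_iff = adjunction.transpose_eq_iff[OF adj]
lemmas \<phi>_post = adjunction.transpose_post[OF adj]
lemmas \<phi>_pre = adjunction.transpose_pre[OF adj]
lemmas \<phi>_Zero = transpose_Zero[OF preadditive_category_axioms preadditive_category_axioms adj]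

lemma \<Phi>:
  assumes "i \<in> {1..n}" "j \<in> {1..n}" "i + j \<le> n"
  shows "natural_transformation A A (F i \<circ>\<^sub>F F j) (F (i + j)) (\<Phi> i j)"
  using assoc assms by (auto simp: associative_family_def)

lemma \<Phi>_hom:
  assumes "i \<in> {1..n}" "j \<in> {1..n}" "i + j \<le> n" "X \<in> Obj A"
  shows "\<Phi> i j X \<in> homset A (fobj (F i) (fobj (F j) X)) (fobj (F (i + j)) X)"
  using natural_transformation.component_in_homset[OF \<Phi>[OF assms(1-3)] assms(4)]
  by (simp add: funct_comp_def)

lemma \<Phi>_natural:
  assumes "i \<in> {1..n}" "j \<in> {1..n}" "i + j \<le> n" "f \<in> homset A X Y"
  shows "\<Phi> i j Y \<cdot> farr (F i) (farr (F j) f) = farr (F (i + j)) f \<cdot> \<Phi> i j X"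
  using natural_transformation.naturality[OF \<Phi>[OF assms(1-3)] assms(4)]
  by (simp add: funct_comp_def)

lemma \<Phi>_assoc:
  assumes "i \<in> {1..n}" "j \<in> {1..n}" "k \<in> {1..n}" "i + j + k \<le> n" "X \<in> Obj A"
  shows "\<Phi> i (j + k) X \<cdot> farr (F i) (\<Phi> j k X) = \<Phi> (i + j) k X \<cdot> \<Phi> i j (fobj (F k) X)"
proof -
  have "i + j + k \<in> {1..n}" using assms by auto
  then show ?thesis
    using assoc assms unfolding associative_family_def by blast
qed

section \<open>The mates of \<open>\<Phi>\<close> and their coassociativity\<close>

abbreviation \<epsilon> :: "nat \<Rightarrow> 'o \<Rightarrow> 'a" where
  "\<epsilon> i \<equiv> adjunction.counit A A (F i) (G i) (\<phi> i)"

lemmas \<epsilon>_hom = adjunction.counit_in_homset[OF adj]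
lemmas \<phi>_\<epsilon> = adjunction.transpose_counit[OF adj]
lemmas \<epsilon>_\<phi> = adjunction.counit_transpose[OF adj]

text \<open>The formula is forced by the characterising identity: for
  \<open>h = \<epsilon> (i + j) X\<close> the transpose of \<open>h\<close> is an identity, so the
  double transpose of \<open>h \<cdot> \<Phi> j i Y\<close> has to be the component itself.\<close>

definition mate :: "nat \<Rightarrow> nat \<Rightarrow> 'o \<Rightarrow> 'a" where
  "mate i j X = (let Y = fobj (G (i + j)) X in
    \<phi> i Y (fobj (G j) X) (\<phi> j (fobj (F i) Y) X (\<epsilon> (i + j) X \<cdot> \<Phi> j i Y)))"

text \<open>Reduction to the universal case. The counit writes \<open>h\<close> as
  \<open>\<epsilon> (i + j) X\<close> after the image under \<open>F (i + j)\<close> of its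
  transpose \<open>h'\<close>, and naturality of \<open>\<Phi> j i\<close> moves \<open>h'\<close>
  to the far right.\<close>

lemma mate_transpose:
  assumes ij: "i \<in> {1..n}" "j \<in> {1..n}" "i + j \<le> n"
    and Y: "Y \<in> Obj A" and h: "h \<in> homset A (fobj (F (i + j)) Y) X"
  shows "mate i j X \<cdot> \<phi> (i + j) Y X h = \<phi> i Y (fobj (G j) X) (\<phi> j (fobj (F i) Y) X (h \<cdot> \<Phi> j i Y))"
proof -
  have k: "i + j \<in> {1..n}" and ji: "j + i \<le> n" using ij by auto
  have X: "X \<in> Obj A" using homset_Obj h by blast
  define Z where "Z = fobj (G (i + j)) X"
  define h' where "h' = \<phi> (i + j) Y X h"
  have Z: "Z \<in> Obj A" unfolding Z_def using G_Obj k X by blast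
  have h': "h' \<in> homset A Y Z" unfolding Z_def h'_def using \<phi>_hom k Y h by blast
  have \<epsilon>: "\<epsilon> (i + j) X \<in> homset A (fobj (F (i + j)) Z) X"
    unfolding Z_def using \<epsilon>_hom k X by blast
  have \<Phi>Z: "\<Phi> j i Z \<in> homset A (fobj (F j) (fobj (F i) Z)) (fobj (F (i + j)) Z)"
    and \<Phi>Y: "\<Phi> j i Y \<in> homset A (fobj (F j) (fobj (F i) Y)) (fobj (F (i + j)) Y)"
    using \<Phi>_hom[OF ij(2,1) ji] Z Y by (simp_all add: add.commute)
  note Fh = F_hom[OF ij(1) h'] F_hom[OF k h']
  note FFh = F_hom[OF ij(2) Fh(1)]
  have "h \<cdot> \<Phi> j i Y = (\<epsilon> (i + j) X \<cdot> farr (F (i + j)) h') \<cdot> \<Phi> j i Y"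
    using \<epsilon>_\<phi>[OF k Y h] by (simp add: h'_def)
  also have "\<dots> = \<epsilon> (i + j) X \<cdot> (farr (F (i + j)) h' \<cdot> \<Phi> j i Y)"
    by (rule Comp_assoc[OF \<Phi>Y Fh(2) \<epsilon>])
  also have "\<dots> = \<epsilon> (i + j) X \<cdot> (\<Phi> j i Z \<cdot> farr (F j) (farr (F i) h'))"
    using \<Phi>_natural[OF ij(2,1) ji h'] by (simp add: add.commute)
  also have "\<dots> = (\<epsilon> (i + j) X \<cdot> \<Phi> j i Z) \<cdot> farr (F j) (farr (F i) h')"
    by (rule Comp_assoc[OF FFh \<Phi>Z \<epsilon>, symmetric])
  finally have eq: "h \<cdot> \<Phi> j i Y = (\<epsilon> (i + j) X \<cdot> \<Phi> j i Z) \<cdot> farr (F j) (farr (F i) h')" .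
  have e: "\<epsilon> (i + j) X \<cdot> \<Phi> j i Z \<in> homset A (fobj (F j) (fobj (F i) Z)) X"
    using Comp_in_homset[OF \<Phi>Z \<epsilon>] .
  note e' = \<phi>_hom[OF ij(2) F_Obj[OF ij(1) Z] e]
  \<comment> \<open>The inner transposition, along \<open>F j\<close>, releases
    \<open>farr (F i) h'\<close>; the outer one, along \<open>F i\<close>, then releases
    \<open>h'\<close>.\<close>
  show ?thesis
    unfolding eq \<phi>_pre[OF ij(2) Fh(1) e] \<phi>_pre[OF ij(1) h' e']
    by (simp add: mate_def Let_def Z_def h'_def)
qed

lemma mate_hom:
  assumes ij: "i \<in> {1..n}" "j \<in> {1..n}" "i + j \<le> n" and X: "X \<in> Obj A"
  shows "mate i j X \<in> homset A (fobj (G (i + j)) X) (fobj (G i) (fobj (G j) X))"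
proof -
  have k: "i + j \<in> {1..n}" and ji: "j + i \<le> n" using ij by auto
  note Z = G_Obj[OF k X]
  have "\<epsilon> (i + j) X \<cdot> \<Phi> j i (fobj (G (i + j)) X)
    \<in> homset A (fobj (F j) (fobj (F i) (fobj (G (i + j)) X))) X"
    using Comp_in_homset[OF _ \<epsilon>_hom[OF k X]] \<Phi>_hom[OF ij(2,1) ji Z] by (simp add: add.commute)
  then show ?thesis
    unfolding mate_def Let_def
    using \<phi>_hom ij Z F_Obj by blast
qed

text \<open>\<open>mate_transpose\<close> is applied to
  \<open>v \<cdot> \<epsilon> (i + j) X\<close>, whose transpose is
  \<open>farr (G (i + j)) v\<close>. In the double transpose, \<open>v\<close> comes out on the left
  by naturality in the codomain.\<close>

lemma mate_natural:
  assumes ij: "i \<in> {1..n}" "j \<in> {1..n}" "i + j \<le> n" and v: "v \<in> homset A X X'"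
  shows "mate i j X' \<cdot> farr (G (i + j)) v = farr (G i) (farr (G j) v) \<cdot> mate i j X"
proof -
  have k: "i + j \<in> {1..n}" and ji: "j + i \<le> n" using ij by auto
  have X: "X \<in> Obj A" using homset_Obj v by blast
  define Z where "Z = fobj (G (i + j)) X"
  have Z: "Z \<in> Obj A" unfolding Z_def using G_Obj k X by blast
  have \<epsilon>: "\<epsilon> (i + j) X \<in> homset A (fobj (F (i + j)) Z) X"
    unfolding Z_def using \<epsilon>_hom k X by blast
  have \<Phi>Z: "\<Phi> j i Z \<in> homset A (fobj (F j) (fobj (F i) Z)) (fobj (F (i + j)) Z)"
    using \<Phi>_hom[OF ij(2,1) ji] Z by (simp add: add.commute)
  note e = Comp_in_homset[OF \<Phi>Z \<epsilon>]
  note FZ = F_Obj[OF ij(1) Z]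
  note Gv = G_hom[OF k v]
  have "\<phi> (i + j) Z X' (v \<cdot> \<epsilon> (i + j) X) = farr (G (i + j)) v"
    using \<phi>_post[OF k Z \<epsilon> v] \<phi>_\<epsilon>[OF k X] Comp_Ident_right[OF Gv] by (simp add: Z_def)
  then have "mate i j X' \<cdot> farr (G (i + j)) v =
      \<phi> i Z (fobj (G j) X') (\<phi> j (fobj (F i) Z) X' ((v \<cdot> \<epsilon> (i + j) X) \<cdot> \<Phi> j i Z))"
    using mate_transpose[OF ij Z Comp_in_homset[OF \<epsilon> v]] by simp
  also have "\<dots> = farr (G i) (farr (G j) v) \<cdot> mate i j X"
    unfolding Comp_assoc[OF \<Phi>Z \<epsilon> v] \<phi>_post[OF ij(2) FZ e v]
      \<phi>_post[OF ij(1) Z \<phi>_hom[OF ij(2) FZ e] G_hom[OF ij(2) v]]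
    by (simp add: mate_def Let_def Z_def)
  finally show ?thesis .
qed

text \<open>Both sides are threefold transposes, along \<open>F k\<close>, \<open>F j\<close> and
  \<open>F i\<close>, of morphisms from \<open>F\<^sub>k F\<^sub>j F\<^sub>i Z\<close> to
  \<open>X\<close>. These agree by associativity of \<open>\<Phi>\<close>.\<close>

lemma mate_coassoc:
  assumes ijk: "i \<in> {1..n}" "j \<in> {1..n}" "k \<in> {1..n}" "i + j + k \<le> n" and X: "X \<in> Obj A"
  shows "farr (G i) (mate j k X) \<cdot> mate i (j + k) X = mate i j (fobj (G k) X) \<cdot> mate (i + j) k X"
proof -
  have ij: "i + j \<in> {1..n}" "i + j \<le> n" and jk: "j + k \<in> {1..n}" "j + k \<le> n"
    and m: "i + j + k \<in> {1..n}" using ijk by auto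
  define Z where "Z = fobj (G (i + j + k)) X"
  have Z: "Z \<in> Obj A" unfolding Z_def using G_Obj m X by blast
  have \<epsilon>: "\<epsilon> (i + j + k) X \<in> homset A (fobj (F (i + j + k)) Z) X"
    unfolding Z_def using \<epsilon>_hom m X by blast
  have 1: "\<Phi> (j + k) i Z \<in> homset A (fobj (F (j + k)) (fobj (F i) Z)) (fobj (F (i + j + k)) Z)"
    using \<Phi>_hom[OF jk(1) ijk(1) _ Z] ijk by (simp add: ac_simps)
  have 2: "\<Phi> k (i + j) Z \<in> homset A (fobj (F k) (fobj (F (i + j)) Z)) (fobj (F (i + j + k)) Z)"
    using \<Phi>_hom[OF ijk(3) ij(1) _ Z] ijk by (simp add: ac_simps)
  have 3: "\<Phi> j i Z \<in> homset A (fobj (F j) (fobj (F i) Z)) (fobj (F (i + j)) Z)"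
    using \<Phi>_hom[OF ijk(2,1) _ Z] ij by (simp add: ac_simps)
  note FZ = F_Obj[OF ijk(1) Z] F_Obj[OF ij(1) Z]
  have 4: "\<Phi> k j (fobj (F i) Z)
      \<in> homset A (fobj (F k) (fobj (F j) (fobj (F i) Z))) (fobj (F (j + k)) (fobj (F i) Z))"
    using \<Phi>_hom[OF ijk(3,2) _ FZ(1)] jk by (simp add: ac_simps)
  note e1 = Comp_in_homset[OF 1 \<epsilon>] and e2 = Comp_in_homset[OF 2 \<epsilon>]
  have mate1: "mate i (j + k) X = \<phi> i Z (fobj (G (j + k)) X)
      (\<phi> (j + k) (fobj (F i) Z) X (\<epsilon> (i + j + k) X \<cdot> \<Phi> (j + k) i Z))"
    by (simp add: mate_def Let_def Z_def add.assoc)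
  have mate2: "mate (i + j) k X = \<phi> (i + j) Z (fobj (G k) X)
      (\<phi> k (fobj (F (i + j)) Z) X (\<epsilon> (i + j + k) X \<cdot> \<Phi> k (i + j) Z))"
    by (simp add: mate_def Let_def Z_def)
  \<comment> \<open>Associativity is used with the indices in the reverse order
    \<open>k, j, i\<close>, as taking mates swaps them.\<close>
  have assoc_kji: "\<Phi> k (i + j) Z \<cdot> farr (F k) (\<Phi> j i Z) =
      \<Phi> (j + k) i Z \<cdot> \<Phi> k j (fobj (F i) Z)"
    using \<Phi>_assoc[OF ijk(3,2,1) _ Z] ijk(4) by (simp add: ac_simps)
  have eq: "(\<epsilon> (i + j + k) X \<cdot> \<Phi> k (i + j) Z) \<cdot> farr (F k) (\<Phi> j i Z) =
      (\<epsilon> (i + j + k) X \<cdot> \<Phi> (j + k) i Z) \<cdot> \<Phi> k j (fobj (F i) Z)"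
    unfolding Comp_assoc[OF 4 1 \<epsilon>] Comp_assoc[OF F_hom[OF ijk(3) 3] 2 \<epsilon>] assoc_kji ..
  \<comment> \<open>Naturality in the codomain brings \<open>mate j k X\<close> inside the
    transposition along \<open>F i\<close>, where \<open>mate_transpose\<close> applies over the
    object \<open>fobj (F i) Z\<close>.\<close>
  have "farr (G i) (mate j k X) \<cdot> mate i (j + k) X =
      \<phi> i Z (fobj (G j) (fobj (G k) X))
        (mate j k X \<cdot> \<phi> (j + k) (fobj (F i) Z) X (\<epsilon> (i + j + k) X \<cdot> \<Phi> (j + k) i Z))"
    unfolding mate1
    by (rule \<phi>_post[OF ijk(1) Z \<phi>_hom[OF jk(1) FZ(1) e1] mate_hom[OF ijk(2,3) jk(2) X], symmetric])
  also have "\<dots> = \<phi> i Z (fobj (G j) (fobj (G k) X)) (\<phi> j (fobj (F i) Z) (fobj (G k) X)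
      (\<phi> k (fobj (F j) (fobj (F i) Z)) X
        ((\<epsilon> (i + j + k) X \<cdot> \<Phi> (j + k) i Z) \<cdot> \<Phi> k j (fobj (F i) Z))))"
    unfolding mate_transpose[OF ijk(2,3) jk(2) FZ(1) e1] ..
  \<comment> \<open>After the exchange by \<open>eq\<close>, the factor
    \<open>farr (F k) (\<Phi> j i Z)\<close> leaves the transposition along \<open>F k\<close> as
    \<open>\<Phi> j i Z\<close>, which is the shape for \<open>mate_transpose\<close> at
    \<open>fobj (G k) X\<close>.\<close>
  also have "\<dots> = \<phi> i Z (fobj (G j) (fobj (G k) X)) (\<phi> j (fobj (F i) Z) (fobj (G k) X)
      (\<phi> k (fobj (F (i + j)) Z) X (\<epsilon> (i + j + k) X \<cdot> \<Phi> k (i + j) Z) \<cdot> \<Phi> j i Z))"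
    unfolding eq[symmetric] \<phi>_pre[OF ijk(3) 3 e2] ..
  also have "\<dots> = mate i j (fobj (G k) X) \<cdot> mate (i + j) k X"
    unfolding mate2
    by (rule mate_transpose[OF ijk(1,2) ij(2) Z \<phi>_hom[OF ijk(3) FZ(2) e2], symmetric])
  finally show ?thesis .
qed

lemma coassociative_mate: "coassociative_family n A G mate"
proof -
  have "natural_transformation A A (G (i + j)) (G i \<circ>\<^sub>F G j) (mate i j)"
    if ij: "i \<in> {1..n}" "j \<in> {1..n}" "i + j \<in> {1..n}" for i j
  proof -
    interpret K: category_functor A A "G (i + j)" using G ij by blast
    interpret GG: category_functor A A "G i \<circ>\<^sub>F G j"
      using G ij category_functor_funct_comp by blast
    show ?thesis
      using ij by unfold_locales (auto simp: funct_comp_def mate_natural intro!: mate_hom)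
  qed
  then show ?thesis
    using mate_coassoc by (simp add: coassociative_family_def)
qed

section \<open>The two trivial extensions as categories of structured objects\<close>

definition right_ext_mor :: "'o \<times> (nat \<Rightarrow> 'a) \<Rightarrow> 'a \<Rightarrow> 'o \<times> (nat \<Rightarrow> 'a) \<Rightarrow> bool" where
  "right_ext_mor P \<gamma> Q \<longleftrightarrow> (\<forall>i \<in> {1..n}. \<gamma> \<cdot> snd P i = snd Q i \<cdot> farr (F i) \<gamma>)"

definition left_ext_mor :: "'o \<times> (nat \<Rightarrow> 'a) \<Rightarrow> 'a \<Rightarrow> 'o \<times> (nat \<Rightarrow> 'a) \<Rightarrow> bool" where
  "left_ext_mor P \<gamma> Q \<longleftrightarrow> (\<forall>i \<in> {1..n}. snd Q i \<cdot> \<gamma> = farr (G i) \<gamma> \<cdot> snd P i)"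

lemma right_trivial_extension_eq:
  "right_trivial_extension n A F \<Phi> = structure_category A (right_ext_Obj n A F \<Phi>) right_ext_mor"
  by (auto simp: right_trivial_extension_def structure_category_def right_ext_mor_def)

lemma left_trivial_extension_eq:
  "left_trivial_extension n A G \<Psi> = structure_category A (left_ext_Obj n A G \<Psi>) left_ext_mor"
  by (auto simp: left_trivial_extension_def structure_category_def left_ext_mor_def)

lemma right_ext_ObjD:
  assumes "P \<in> right_ext_Obj n A F \<Phi>"
  shows "fst P \<in> Obj A" "i \<in> {1..n} \<Longrightarrow> snd P i \<in> homset A (fobj (F i) (fst P)) (fst P)"
    "snd P \<in> extensional {1..n}"
  using assms by (auto simp: right_ext_Obj_def PiE_def)

lemma left_ext_ObjD:
  assumes "P \<in> left_ext_Obj n A G \<Psi>"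
  shows "fst P \<in> Obj A" "i \<in> {1..n} \<Longrightarrow> snd P i \<in> homset A (fst P) (fobj (G i) (fst P))"
    "snd P \<in> extensional {1..n}"
  using assms by (auto simp: left_ext_Obj_def PiE_def)

text \<open>Identities satisfy the condition because \<open>F i\<close> preserves them; the
  commuting squares of \<open>\<gamma>\<close> and \<open>\<delta>\<close> paste because
  \<open>F i\<close> preserves composites.\<close>

lemma right_structures: "structures A (right_ext_Obj n A F \<Phi>) right_ext_mor"
proof
  fix P assume P: "P \<in> right_ext_Obj n A F \<Phi>"
  note D = right_ext_ObjD[OF P]
  show "fst P \<in> Obj A" by (fact D)
  show "right_ext_mor P (Ident A (fst P)) P"
    using D(1) Comp_Ident_left[OF D(2)] Comp_Ident_right[OF D(2)]
    by (simp add: right_ext_mor_def F_Ident)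
next
  fix P Q S \<gamma> \<delta>
  assume P: "P \<in> right_ext_Obj n A F \<Phi>" and Q: "Q \<in> right_ext_Obj n A F \<Phi>"
    and S: "S \<in> right_ext_Obj n A F \<Phi>"
    and \<gamma>: "\<gamma> \<in> homset A (fst P) (fst Q)" and \<delta>: "\<delta> \<in> homset A (fst Q) (fst S)"
    and m: "right_ext_mor P \<gamma> Q" "right_ext_mor Q \<delta> S"
  show "right_ext_mor P (\<delta> \<cdot> \<gamma>) S"
    unfolding right_ext_mor_def
  proof
    fix i assume i: "i \<in> {1..n}"
    note p = right_ext_ObjD(2)[OF P i] and q = right_ext_ObjD(2)[OF Q i]
      and s = right_ext_ObjD(2)[OF S i]
    show "(\<delta> \<cdot> \<gamma>) \<cdot> snd P i = snd S i \<cdot> farr (F i) (\<delta> \<cdot> \<gamma>)"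
      using m i Comp_assoc[OF p \<gamma> \<delta>] Comp_assoc[OF F_hom[OF i \<gamma>] q \<delta>]
        Comp_assoc[OF F_hom[OF i \<gamma>] F_hom[OF i \<delta>] s]
      by (simp add: right_ext_mor_def F_Comp[OF i \<gamma> \<delta>])
  qed
qed

lemma left_structures: "structures A (left_ext_Obj n A G \<Psi>) left_ext_mor"
proof
  fix P assume P: "P \<in> left_ext_Obj n A G \<Psi>"
  note D = left_ext_ObjD[OF P]
  show "fst P \<in> Obj A" by (fact D)
  show "left_ext_mor P (Ident A (fst P)) P"
    using D(1) Comp_Ident_left[OF D(2)] Comp_Ident_right[OF D(2)]
    by (simp add: left_ext_mor_def G_Ident)
next
  fix P Q S \<gamma> \<delta>
  assume P: "P \<in> left_ext_Obj n A G \<Psi>" and Q: "Q \<in> left_ext_Obj n A G \<Psi>"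
    and S: "S \<in> left_ext_Obj n A G \<Psi>"
    and \<gamma>: "\<gamma> \<in> homset A (fst P) (fst Q)" and \<delta>: "\<delta> \<in> homset A (fst Q) (fst S)"
    and m: "left_ext_mor P \<gamma> Q" "left_ext_mor Q \<delta> S"
  show "left_ext_mor P (\<delta> \<cdot> \<gamma>) S"
    unfolding left_ext_mor_def
  proof
    fix i assume i: "i \<in> {1..n}"
    note p = left_ext_ObjD(2)[OF P i] and q = left_ext_ObjD(2)[OF Q i]
      and s = left_ext_ObjD(2)[OF S i]
    show "snd S i \<cdot> (\<delta> \<cdot> \<gamma>) = farr (G i) (\<delta> \<cdot> \<gamma>) \<cdot> snd P i"
      using m i Comp_assoc[OF \<gamma> \<delta> s] Comp_assoc[OF \<gamma> q G_hom[OF i \<delta>]]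
        Comp_assoc[OF p G_hom[OF i \<gamma>] G_hom[OF i \<delta>]]
      by (simp add: left_ext_mor_def G_Comp[OF i \<gamma> \<delta>])
  qed
qed

section \<open>Transposing structures and the isomorphism of the extensions\<close>

definition transpose_obj :: "'o \<times> (nat \<Rightarrow> 'a) \<Rightarrow> 'o \<times> (nat \<Rightarrow> 'a)" where
  "transpose_obj P = (fst P, \<lambda>i \<in> {1..n}. \<phi> i (fst P) (fst P) (snd P i))"

text \<open>As in \<open>transpose_obj\<close>, restricting to \<open>{1..n}\<close> keeps the
  family extensional, so that the round trips are equalities of pairs.\<close>

definition untranspose_obj :: "'o \<times> (nat \<Rightarrow> 'a) \<Rightarrow> 'o \<times> (nat \<Rightarrow> 'a)" where
  "untranspose_obj P = (fst P, \<lambda>i \<in> {1..n}.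
    inv_into (homset A (fobj (F i) (fst P)) (fst P)) (\<phi> i (fst P) (fst P)) (snd P i))"

text \<open>Transposing along \<open>F i\<close> and then along \<open>F j\<close> turns the
  equation for \<open>(i, j)\<close> on \<open>f\<close> into the equation for \<open>(j, i)\<close>
  on the transposed family. Double transposition is injective, so nothing is lost.\<close>

lemma transpose_in_left_ext_iff:
  assumes X: "X \<in> Obj A" and f: "f \<in> (\<Pi>\<^sub>E i \<in> {1..n}. homset A (fobj (F i) X) X)"
  shows "transpose_obj (X, f) \<in> left_ext_Obj n A G mate \<longleftrightarrow> (X, f) \<in> right_ext_Obj n A F \<Phi>"
proof -
  define g where "g = (\<lambda>i \<in> {1..n}. \<phi> i X X (f i))"
  have f_hom: "f i \<in> homset A (fobj (F i) X) X" if "i \<in> {1..n}" for i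
    using f that by (auto simp: PiE_def)
  have g: "g \<in> (\<Pi>\<^sub>E i \<in> {1..n}. homset A X (fobj (G i) X))"
    using f_hom \<phi>_hom[OF _ X] by (auto simp: g_def)
  have gi: "g i = \<phi> i X X (f i)" if "i \<in> {1..n}" for i
    using that by (simp add: g_def)
  \<comment> \<open>The inner transpose is \<open>g i \<cdot> f j\<close> by naturality in the
    domain; naturality in the codomain then handles the outer one.\<close>
  have key: "farr (G j) (g i) \<cdot> g j = \<phi> j X (fobj (G i) X) (\<phi> i (fobj (F j) X) X (f i \<cdot> farr (F i) (f j)))"
    if "i \<in> {1..n}" "j \<in> {1..n}" for i j
    unfolding \<phi>_pre[OF that(1) f_hom[OF that(2)] f_hom[OF that(1)]] gi[OF that(1)] gi[OF that(2)]
    by (rule \<phi>_post[OF that(2) X f_hom[OF that(2)] \<phi>_hom[OF that(1) X f_hom[OF that(1)]], symmetric])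
  have inj: "\<phi> j X (fobj (G i) X) (\<phi> i (fobj (F j) X) X a) =
      \<phi> j X (fobj (G i) X) (\<phi> i (fobj (F j) X) X b) \<longleftrightarrow> a = b"
    if "i \<in> {1..n}" "j \<in> {1..n}" "a \<in> homset A (fobj (F i) (fobj (F j) X)) X"
      "b \<in> homset A (fobj (F i) (fobj (F j) X)) X" for i j a b
    using \<phi>_eq_iff[OF that(2) X] \<phi>_eq_iff[OF that(1) F_Obj[OF that(2) X]]
      \<phi>_hom[OF that(1) F_Obj[OF that(2) X]] that by metis
  have ff: "f i \<cdot> farr (F i) (f j) \<in> homset A (fobj (F i) (fobj (F j) X)) X"
    if "i \<in> {1..n}" "j \<in> {1..n}" for i j
    using Comp_in_homset[OF F_hom[OF that(1) f_hom[OF that(2)]] f_hom[OF that(1)]] .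
  have le: "farr (G j) (g i) \<cdot> g j = mate j i X \<cdot> g (j + i) \<longleftrightarrow>
      f i \<cdot> farr (F i) (f j) = f (i + j) \<cdot> \<Phi> i j X"
    if ij: "i \<in> {1..n}" "j \<in> {1..n}" and "i + j \<le> n" for i j
  proof -
    have k: "j + i \<in> {1..n}" "j + i \<le> n" using that by auto
    have "mate j i X \<cdot> g (j + i) =
        \<phi> j X (fobj (G i) X) (\<phi> i (fobj (F j) X) X (f (i + j) \<cdot> \<Phi> i j X))"
      using mate_transpose[OF ij(2,1) k(2) X f_hom[OF k(1)]] gi[OF k(1)]
      by (simp add: add.commute)
    moreover have "f (i + j) \<cdot> \<Phi> i j X \<in> homset A (fobj (F i) (fobj (F j) X)) X"
      using Comp_in_homset[OF \<Phi>_hom[OF that X] f_hom] k by (simp add: add.commute)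
    ultimately show ?thesis
      using key[OF ij] inj[OF ij ff[OF ij]] by simp
  qed
  have gt: "farr (G j) (g i) \<cdot> g j = Zero A X (fobj (G j) (fobj (G i) X)) \<longleftrightarrow>
      f i \<cdot> farr (F i) (f j) = Zero A (fobj (F i) (fobj (F j) X)) X"
    if ij: "i \<in> {1..n}" "j \<in> {1..n}" for i j
  proof -
    have "Zero A X (fobj (G j) (fobj (G i) X)) =
        \<phi> j X (fobj (G i) X) (\<phi> i (fobj (F j) X) X (Zero A (fobj (F i) (fobj (F j) X)) X))"
      by (simp add: \<phi>_Zero[OF ij(1) F_Obj[OF ij(2) X] X] \<phi>_Zero[OF ij(2) X G_Obj[OF ij(1) X]])
    moreover have "Zero A (fobj (F i) (fobj (F j) X)) X \<in> homset A (fobj (F i) (fobj (F j) X)) X"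
      using Zero_in_homset F_Obj ij X by blast
    ultimately show ?thesis
      using key[OF ij] inj[OF ij ff[OF ij]] by simp
  qed
  \<comment> \<open>The names \<open>i\<close> and \<open>j\<close> are exchanged in the first half,
    which is the condition of \<open>left_ext_Obj\<close> up to renaming of bound variables.\<close>
  have "(\<forall>j \<in> {1..n}. \<forall>i \<in> {1..n}.
      (j + i \<le> n \<longrightarrow> farr (G j) (g i) \<cdot> g j = mate j i X \<cdot> g (j + i)) \<and>
      (j + i > n \<longrightarrow> farr (G j) (g i) \<cdot> g j = Zero A X (fobj (G j) (fobj (G i) X)))) \<longleftrightarrow>
    (\<forall>i \<in> {1..n}. \<forall>j \<in> {1..n}.
      (i + j \<le> n \<longrightarrow> f i \<cdot> farr (F i) (f j) = f (i + j) \<cdot> \<Phi> i j X) \<and>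
      (i + j > n \<longrightarrow> f i \<cdot> farr (F i) (f j) = Zero A (fobj (F i) (fobj (F j) X)) X))"
    using le gt by (metis add.commute)
  then show ?thesis
    using X f g unfolding transpose_obj_def left_ext_Obj_def right_ext_Obj_def fst_conv snd_conv
      g_def[symmetric] by simp
qed

lemma transpose_obj:
  assumes P: "P \<in> right_ext_Obj n A F \<Phi>"
  shows "transpose_obj P \<in> left_ext_Obj n A G mate" "untranspose_obj (transpose_obj P) = P"
proof -
  note D = right_ext_ObjD[OF P]
  show "transpose_obj P \<in> left_ext_Obj n A G mate"
    using P transpose_in_left_ext_iff[of "fst P" "snd P"] D by (auto simp: PiE_def)
  have "snd (untranspose_obj (transpose_obj P)) = snd P"
  proof (rule extensionalityI[OF _ D(3)])
    fix i assume i: "i \<in> {1..n}"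
    show "snd (untranspose_obj (transpose_obj P)) i = snd P i"
      using i adjunction.bij[OF adj[OF i] D(1) D(1)] D(2)[OF i]
      by (simp add: untranspose_obj_def transpose_obj_def bij_betw_def)
  qed (simp add: untranspose_obj_def)
  then show "untranspose_obj (transpose_obj P) = P"
    by (simp add: prod_eq_iff untranspose_obj_def transpose_obj_def)
qed

lemma untranspose_obj:
  assumes P: "P \<in> left_ext_Obj n A G mate"
  shows "untranspose_obj P \<in> right_ext_Obj n A F \<Phi>" "transpose_obj (untranspose_obj P) = P"
proof -
  note D = left_ext_ObjD[OF P]
  have img: "snd P i \<in> \<phi> i (fst P) (fst P) ` homset A (fobj (F i) (fst P)) (fst P)"
    if i: "i \<in> {1..n}" for i
    using adjunction.bij[OF adj[OF i] D(1) D(1)] D(2)[OF i] by (simp add: bij_betw_def)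
  have "snd (transpose_obj (untranspose_obj P)) = snd P"
  proof (rule extensionalityI[OF _ D(3)])
    fix i assume i: "i \<in> {1..n}"
    show "snd (transpose_obj (untranspose_obj P)) i = snd P i"
      using i f_inv_into_f[OF img[OF i]]
      by (simp add: untranspose_obj_def transpose_obj_def)
  qed (simp add: transpose_obj_def)
  then show eq: "transpose_obj (untranspose_obj P) = P"
    by (simp add: prod_eq_iff untranspose_obj_def transpose_obj_def)
  have "snd (untranspose_obj P) \<in> (\<Pi>\<^sub>E i \<in> {1..n}. homset A (fobj (F i) (fst P)) (fst P))"
    using inv_into_into[OF img] by (auto simp: untranspose_obj_def)
  \<comment> \<open>By \<open>eq\<close> the transpose of this pair is \<open>P\<close>, so the
    equivalence carries the equations back; this is why the round trip comes first.\<close>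
  then show "untranspose_obj P \<in> right_ext_Obj n A F \<Phi>"
    using transpose_in_left_ext_iff[OF D(1), of "snd (untranspose_obj P)"] P eq
    by (simp add: untranspose_obj_def)
qed

text \<open>\<open>\<phi> i\<close> sends the two sides of the square on the right to the two sides
  of the square on the left, by naturality in the codomain and in the domain, and it is
  injective.\<close>

lemma left_ext_mor_transpose_iff:
  assumes P: "P \<in> right_ext_Obj n A F \<Phi>" and Q: "Q \<in> right_ext_Obj n A F \<Phi>"
    and \<gamma>: "\<gamma> \<in> homset A (fst P) (fst Q)"
  shows "left_ext_mor (transpose_obj P) \<gamma> (transpose_obj Q) \<longleftrightarrow> right_ext_mor P \<gamma> Q"
proof -
  have "snd (transpose_obj Q) i \<cdot> \<gamma> = farr (G i) \<gamma> \<cdot> snd (transpose_obj P) i \<longleftrightarrow>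
      \<gamma> \<cdot> snd P i = snd Q i \<cdot> farr (F i) \<gamma>" if i: "i \<in> {1..n}" for i
  proof -
    note X = right_ext_ObjD(1)[OF P]
    note p = right_ext_ObjD(2)[OF P i] and q = right_ext_ObjD(2)[OF Q i]
    show ?thesis
      using i \<phi>_post[OF i X p \<gamma>] \<phi>_pre[OF i \<gamma> q]
        \<phi>_eq_iff[OF i X Comp_in_homset[OF p \<gamma>] Comp_in_homset[OF F_hom[OF i \<gamma>] q]]
      by (auto simp: transpose_obj_def)
  qed
  then show ?thesis
    by (simp add: left_ext_mor_def right_ext_mor_def)
qed

lemma isomorphic_trivial_extensions:
  "isomorphic_categories (right_trivial_extension n A F \<Phi>) (left_trivial_extension n A G mate)"
  unfolding right_trivial_extension_eq left_trivial_extension_eq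
proof (rule isomorphic_structure_categories[OF right_structures left_structures])
  fix P assume "P \<in> right_ext_Obj n A F \<Phi>"
  then show "transpose_obj P \<in> left_ext_Obj n A G mate \<and> fst (transpose_obj P) = fst P \<and>
      untranspose_obj (transpose_obj P) = P"
    using transpose_obj by (simp add: transpose_obj_def)
next
  fix P assume "P \<in> left_ext_Obj n A G mate"
  then show "untranspose_obj P \<in> right_ext_Obj n A F \<Phi> \<and> fst (untranspose_obj P) = fst P \<and>
      transpose_obj (untranspose_obj P) = P"
    using untranspose_obj by (simp add: untranspose_obj_def)
qed (rule left_ext_mor_transpose_iff)

end

theorem theorem2p5:
  fixes A :: "('o, 'a, 'z) preadditive_category_scheme"
    and n :: nat
    and F G :: "nat \<Rightarrow> ('o, 'a, 'o, 'a) funct"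
    and \<Phi> :: "nat \<Rightarrow> nat \<Rightarrow> 'o \<Rightarrow> 'a"
  assumes "abelian_category A"
    and "n \<ge> 1"
    and "\<And>i. i \<in> {1..n} \<Longrightarrow> additive_functor A A (F i)"
    and "associative_family n A F \<Phi>"
    and "\<And>i. i \<in> {1..n} \<Longrightarrow> is_right_adjoint A A (F i) (G i)"
  shows "\<exists>\<Psi> :: nat \<Rightarrow> nat \<Rightarrow> 'o \<Rightarrow> 'a. coassociative_family n A G \<Psi> \<and>
    isomorphic_categories (right_trivial_extension n A F \<Phi>) (left_trivial_extension n A G \<Psi>)"
proof -
  \<comment> \<open>\<open>is_right_adjoint\<close> only asserts that transposition bijections
    exist; one is chosen for each index, and the witness \<open>mate\<close> for
    \<open>\<Psi>\<close> is built from this choice.\<close>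
  have "\<forall>i \<in> {1..n}. \<exists>\<phi>. adjunction A A (F i) (G i) \<phi>"
    using assms(5) by (simp add: is_right_adjoint_def)
  then obtain \<phi> where \<phi>: "\<And>i. i \<in> {1..n} \<Longrightarrow> adjunction A A (F i) (G i) (\<phi> i)"
    by metis
  interpret graded_adjunction A n F G \<phi> \<Phi>
    using assms(1,4) \<phi>
    by (simp add: graded_adjunction_def graded_adjunction_axioms_def abelian_category_def)
  show ?thesis
    using coassociative_mate isomorphic_trivial_extensions by blast
qed

end
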